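(* Let $A\in\mathbb{R}^{n\times n}$ be symmetric with eigenvalues $\lambda_1\ge\dots\ge\lambda_r>\lambda_{r+1}\ge\lambda_{r+2}\ge\dots\ge\lambda_n$ (where $r\ge1$ and $r+2\le n$) satisfying $\min_{k=1,\dots,r}|\lambda_k|>\max_{k=r+1,\dots,n}|\lambda_k|$, and let $v_1,\dots,v_n$ be corresponding orthonormal eigenvectors. Let $V=[v_1,\dots,v_r]$ and $V_\perp=[v_{r+1},\dots,v_n]$, and let $\mu$ be the coherence of $V$. Let $Q_0\in\mathbb{O}_{n,r}$ and $d_0:=\|Q_0^{T}V_\perp\|_2=\mathrm{dist}_2(Q_0,V)$, with $d_0<1$. Then the iterates $\{Q_t\}$ produced by subspace iteration applied to $A$ with initial guess $Q_0$ satisfy $$\mathrm{dist}_{2\to\infty}(Q_t,V)\le\left(\frac{\lambda_{r+1}}{\lambda_r}\right)^{t}\left[\mu\sqrt{\frac{2r}{n}}\cdot\frac{d_0}{\sqrt{1-d_0^2}}+\frac{\|v_{r+1}v_{r+1}^{T}\|_\infty}{\sqrt{1-d_0^2}}\cdot\mathrm{dist}_{2\to\infty}(Q_0,V)\right]+\left(\frac{\lambda_{r+2}}{\lambda_r}\right)^{t}\frac{d_0}{\sqrt{1-d_0^2}}.$$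
   Context: Norms: $\|\cdot\|_2$ is the spectral norm; $\|M\|_\infty=\max_i\|M_{i,:}\|_1$ (maximum absolute row sum); $\|M\|_{2\to\infty}=\max_i\|M_{i,:}\|_2$ (maximum Euclidean row norm), where $M_{i,:}$ is the $i$-th row of $M$. $\mathbb{O}_{n,r}$ is the set of $U\in\mathbb{R}^{n\times r}$ with $U^{T}U=I_r$, and $\mathbb{O}_r=\mathbb{O}_{r,r}$. For $U,W\in\mathbb{O}_{n,r}$: $\mathrm{dist}_2(U,W)=\|UU^{T}-WW^{T}\|_2$ and $\mathrm{dist}_{2\to\infty}(U,W)=\inf_{O\in\mathbb{O}_r}\|U-WO\|_{2\to\infty}$. Coherence: for $V\in\mathbb{O}_{n,r}$, the coherence of $V$ is the smallest $\mu>0$ with $\|V\|_{2\to\infty}\le\mu\sqrt{r/n}$. Subspace iteration: for $t=1,2,\dots$, set $V^{(t)}=AQ_{t-1}$ and compute a QR decomposition $V^{(t)}=Q_tR_t$ with $Q_t\in\mathbb{O}_{n,r}$ and $R_t\in\mathbb{R}^{r\times r}$ upper triangular.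
   Formalization: In the bound, λ_{r+1} and λ_{r+2} in the ratios are replaced by max_{k≥r+1}|λ_k| and max_{k≥r+2}|λ_k|; with negative trailing eigenvalues the printed bound fails, e.g. A=diag(2,0,-1), r=1, Q_0=(1,0,1)/√2, t=1. *)

theory Defs
  imports "HOL-Analysis.Analysis"
begin

text \<open>
  An n-by-r real matrix is a \<^typ>\<open>real^'r^'n\<close> with \<open>n = CARD('n)\<close> and \<open>r = CARD('r)\<close>.
  Column index types are linearly ordered, so that ``the j-th column'' and ``upper triangular''
  make sense; \<open>pos j\<close> is the position of \<open>j\<close>, counted from 1.
\<close>

definition pos :: "'k::{finite,linorder} \<Rightarrow> nat"
  where "pos j = card {..j}"

text \<open>The matrix with columns \<open>v (s + 1), v (s + 2), \<dots>\<close>\<close>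

definition cols_from :: "nat \<Rightarrow> (nat \<Rightarrow> real^'n) \<Rightarrow> real^'k::{finite,linorder}^'n"
  where "cols_from s v = (\<chi> i j. v (s + pos j) $ i)"

definition spectral_norm :: "real^'m^'n \<Rightarrow> real"
  where "spectral_norm M = onorm ((*v) M)"

definition norm_inf :: "real^'m^'n \<Rightarrow> real"
  where "norm_inf M = (MAX i. \<Sum>j\<in>UNIV. \<bar>M $ i $ j\<bar>)"

definition norm_2_inf :: "real^'m^'n \<Rightarrow> real"
  where "norm_2_inf M = (MAX i. norm (row i M))"

definition orthonormal_mats :: "(real^'r^'n) set"
  where "orthonormal_mats = {U. transpose U ** U = mat 1}"

definition dist_2 :: "real^'r^'n \<Rightarrow> real^'r^'n \<Rightarrow> real"
  where "dist_2 U W = spectral_norm (U ** transpose U - W ** transpose W)"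

definition dist_2_inf :: "real^'r^'n \<Rightarrow> real^'r^'n \<Rightarrow> real"
  where "dist_2_inf U W = (INF X\<in>(orthonormal_mats :: (real^'r^'r) set). norm_2_inf (U - W ** X))"

definition coherence :: "real^'r^'n \<Rightarrow> real"
  where "coherence V =
    (LEAST \<mu>. 0 < \<mu> \<and> norm_2_inf V \<le> \<mu> * sqrt (real CARD('r) / real CARD('n)))"

definition upper_triangular_mat :: "real^'r::{finite,linorder}^'r::{finite,linorder} \<Rightarrow> bool"
  where "upper_triangular_mat R \<longleftrightarrow> (\<forall>i j. j < i \<longrightarrow> R $ i $ j = 0)"

text \<open>
  \<open>Q\<close> is a possible sequence of iterates: QR decompositions are not unique, and every choice
  of them is admitted.
\<close>

definition subspace_iteration ::
    "real^'n^'n \<Rightarrow> real^'r::{finite,linorder}^'n \<Rightarrow> (nat \<Rightarrow> real^'r::{finite,linorder}^'n) \<Rightarrow> bool"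
  where "subspace_iteration A Q0 Q \<longleftrightarrow> Q 0 = Q0 \<and>
    (\<forall>t\<ge>1. Q t \<in> orthonormal_mats \<and>
      (\<exists>R. upper_triangular_mat R \<and> A ** Q (t - 1) = Q t ** R))"

text \<open>
  Convergence rates. The eigenvalues are sorted by value, and the trailing ones may be negative,
  so \<open>\<lambda>\<^sub>r\<^sub>+\<^sub>1\<close> and \<open>\<lambda>\<^sub>r\<^sub>+\<^sub>2\<close> need not be the largest in modulus among
  \<open>\<lambda>\<^sub>r\<^sub>+\<^sub>1, \<dots>, \<lambda>\<^sub>n\<close> and \<open>\<lambda>\<^sub>r\<^sub>+\<^sub>2, \<dots>, \<lambda>\<^sub>n\<close>.
  A rate \<open>(\<lambda>\<^sub>r\<^sub>+\<^sub>2 / \<lambda>\<^sub>r)\<^sup>t\<close> read with signs can make an error bound negative: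
  for \<open>A = diag(2, 0, -1)\<close>, \<open>r = 1\<close>, \<open>t = 1\<close> and \<open>Q\<^sub>0 = (1, 0, 1) / \<surd>2\<close> the bound would be \<open>-1/2\<close>.
  Absolute values alone do not help: for \<open>A = diag(2, 0, 0, -1)\<close> both ratios are 0, but
  one step does not reach the invariant subspace.
  The rates are therefore stated with the modulus maxima of the two tails. These are
  \<open>\<lambda>\<^sub>r\<^sub>+\<^sub>1\<close> and \<open>\<lambda>\<^sub>r\<^sub>+\<^sub>2\<close> themselves whenever the tails are led by
  their largest moduli, in particular for positive semidefinite \<open>A\<close>:
\<close>

lemma tail_max_eq:
  fixes lam :: "nat \<Rightarrow> real"
  assumes "k \<le> n" and "\<forall>i\<in>{k..n}. \<bar>lam i\<bar> \<le> lam k"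
  shows "(MAX i\<in>{k..n}. \<bar>lam i\<bar>) = lam k"
proof (rule Max_eqI)
  have "\<bar>lam k\<bar> = lam k"
    using assms by force
  then show "lam k \<in> (\<lambda>i. \<bar>lam i\<bar>) ` {k..n}"
    using assms(1) by (metis atLeastAtMost_iff image_eqI order_refl)
qed (use assms(2) in auto)

end

theory Submission
  imports Defs
begin

text \<open>
  Write \<open>A\<^sup>t Q\<^sub>0 = Q\<^sub>t R\<close>. In the eigenbasis the leading coordinates are multiplied by at least
  \<open>\<lambda>\<^sub>r\<^sup>t\<close>, and \<open>V\<^sup>T Q\<^sub>0\<close> is bounded below by \<open>c = \<surd>(1 - d\<^sub>0\<^sup>2)\<close>, so \<open>R\<close> is invertible with
  \<open>\<parallel>R\<^sup>-\<^sup>1\<parallel> \<le> 1 / (\<lambda>\<^sub>r\<^sup>t c)\<close>. For orthogonal \<open>X\<close> split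
  \<open>Q\<^sub>t - V X = V (V\<^sup>T Q\<^sub>t - X) + v v\<^sup>T Q\<^sub>t + P Q\<^sub>t\<close>, where \<open>v = v\<^sub>r\<^sub>+\<^sub>1\<close> and \<open>P\<close> projects onto the
  span of \<open>v\<^sub>r\<^sub>+\<^sub>2, \<dots>, v\<^sub>n\<close>. With \<open>X\<close> the polar factor of \<open>V\<^sup>T Q\<^sub>t\<close>, the first term is controlled by
  \<open>\<parallel>V\<^sub>\<perp>\<^sup>T Q\<^sub>t\<parallel>\<^sup>2 \<le> \<parallel>V\<^sub>\<perp>\<^sup>T Q\<^sub>t\<parallel>\<close>; the second equals \<open>\<lambda>\<^sub>r\<^sub>+\<^sub>1\<^sup>t v v\<^sup>T (Q\<^sub>0 - V Y) R\<^sup>-\<^sup>1\<close> for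
  every \<open>Y\<close>, since \<open>v\<^sup>T V = 0\<close>; the last is bounded in the spectral norm.
\<close>

subsection \<open>Matrix norms\<close>

lemma inner_matrix_vector_transpose:
  fixes M :: "real^'m^'n"
  shows "(M *v x) \<bullet> y = x \<bullet> (transpose M *v y)"
  by (metis dot_lmul_matrix transpose_matrix_vector transpose_transpose)

lemma matrix_mult_add_rdistrib: "(A + B) ** C = A ** C + B ** (C :: real^'k^'m)"
  by (simp add: matrix_eq matrix_vector_mult_add_rdistrib flip: matrix_vector_mul_assoc)

lemma matrix_mult_diff_rdistrib: "(A - B) ** C = A ** C - B ** (C :: real^'k^'m)"
  by (simp add: matrix_eq matrix_vector_mult_diff_rdistrib flip: matrix_vector_mul_assoc)

lemma matrix_mult_diff_ldistrib: "C ** (A - B) = C ** A - C ** (B :: real^'k^'m)"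
  by (simp add: matrix_eq matrix_vector_mult_diff_rdistrib matrix_vector_mult_diff_distrib
      flip: matrix_vector_mul_assoc)

lemma norm_le_spectral_norm:
  fixes M :: "real^'m^'n"
  shows "norm (M *v x) \<le> spectral_norm M * norm x"
  unfolding spectral_norm_def by (intro onorm matrix_vector_mul_bounded_linear)

lemma spectral_norm_le:
  fixes M :: "real^'m^'n"
  assumes "\<And>x. norm (M *v x) \<le> b * norm x"
  shows "spectral_norm M \<le> b"
  unfolding spectral_norm_def using assms by (rule onorm_le)

lemma spectral_norm_nonneg: "0 \<le> spectral_norm (M :: real^'m^'n)"
  unfolding spectral_norm_def by (intro onorm_pos_le matrix_vector_mul_bounded_linear)

text \<open>With \<open>y = transpose M *v x\<close>, the square of the norm of \<open>y\<close> is
  \<open>(M *v y) \<bullet> x\<close>. Cauchy-Schwarz and the bound for \<open>M\<close> leave a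
  common factor \<open>norm y\<close> to cancel.\<close>

lemma spectral_norm_transpose_le:
  fixes M :: "real^'m^'n"
  shows "spectral_norm (transpose M) \<le> spectral_norm M"
proof (rule spectral_norm_le)
  fix x :: "real^'n"
  let ?y = "transpose M *v x"
  have "norm ?y * norm ?y = (M *v ?y) \<bullet> x"
    by (simp add: inner_matrix_vector_transpose dot_square_norm power2_eq_square)
  also have "\<dots> \<le> norm (M *v ?y) * norm x"
    by (rule norm_cauchy_schwarz)
  also have "\<dots> \<le> spectral_norm M * norm ?y * norm x"
    by (intro mult_right_mono norm_le_spectral_norm) simp
  finally have "norm ?y * norm ?y \<le> (spectral_norm M * norm x) * norm ?y"
    by (simp add: mult_ac)
  then show "norm ?y \<le> spectral_norm M * norm x"
    by (cases "norm ?y = 0") (use spectral_norm_nonneg[of M] in \<open>auto simp: mult_le_cancel_right\<close>)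
qed

lemma spectral_norm_transpose:
  "spectral_norm (transpose M) = spectral_norm (M :: real^'m^'n)"
  using spectral_norm_transpose_le[of M] spectral_norm_transpose_le[of "transpose M"] by simp

lemma norm_row_le_norm_2_inf: "norm (row i M) \<le> norm_2_inf (M :: real^'m^'n)"
  unfolding norm_2_inf_def by (rule Max_ge) auto

lemma norm_2_inf_le:
  fixes M :: "real^'m^'n"
  assumes "\<And>i. norm (row i M) \<le> b"
  shows "norm_2_inf M \<le> b"
  unfolding norm_2_inf_def using assms by (subst Max_le_iff) auto

lemma norm_2_inf_nonneg: "0 \<le> norm_2_inf (M :: real^'m^'n)"
  using norm_row_le_norm_2_inf norm_ge_zero order_trans by blast

lemma norm_2_inf_add_le: "norm_2_inf (M + N) \<le> norm_2_inf M + norm_2_inf (N :: real^'m^'n)"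
proof (rule norm_2_inf_le)
  fix i
  have "row i (M + N) = row i M + row i N"
    by (simp add: row_def vec_eq_iff)
  then show "norm (row i (M + N)) \<le> norm_2_inf M + norm_2_inf N"
    by (metis norm_triangle_le add_mono norm_row_le_norm_2_inf)
qed

lemma row_eq_transpose_axis: "row i M = transpose M *v axis i (1::real)"
  by (simp add: row_def matrix_vector_mult_basis column_transpose)

lemma row_matrix_mult:
  fixes M :: "real^'m^'n" and N :: "real^'k^'m"
  shows "row i (M ** N) = transpose N *v row i M"
  by (simp add: row_eq_transpose_axis matrix_transpose_mul matrix_vector_mul_assoc
      del: transpose_matrix_vector)

lemma norm_2_inf_le_spectral_norm: "norm_2_inf M \<le> spectral_norm (M :: real^'m^'n)"
proof (rule norm_2_inf_le)
  fix i
  show "norm (row i M) \<le> spectral_norm M"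
    using norm_le_spectral_norm[of "transpose M" "axis i 1"]
    by (simp add: row_eq_transpose_axis spectral_norm_transpose)
qed

text \<open>Row i of the product is \<open>transpose N\<close> applied to row i of \<open>M\<close>,
  and transposing keeps the spectral norm.\<close>

lemma norm_2_inf_mult_le:
  fixes M :: "real^'m^'n" and N :: "real^'k^'m"
  shows "norm_2_inf (M ** N) \<le> norm_2_inf M * spectral_norm N"
proof (rule norm_2_inf_le)
  fix i
  have "norm (row i (M ** N)) \<le> spectral_norm N * norm (row i M)"
    using norm_le_spectral_norm[of "transpose N" "row i M"]
    by (simp add: row_matrix_mult spectral_norm_transpose)
  also have "\<dots> \<le> spectral_norm N * norm_2_inf M"
    by (intro mult_left_mono norm_row_le_norm_2_inf spectral_norm_nonneg)
  finally show "norm (row i (M ** N)) \<le> norm_2_inf M * spectral_norm N"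
    by (simp add: mult.commute)
qed

lemma norm_inf_nonneg: "0 \<le> norm_inf (M :: real^'m^'n)"
proof -
  fix i
  have "0 \<le> (\<Sum>j\<in>UNIV. \<bar>M $ i $ j\<bar>)" by (simp add: sum_nonneg)
  also have "\<dots> \<le> norm_inf M" unfolding norm_inf_def by (rule Max_ge) auto
  finally show ?thesis .
qed

text \<open>Here the rows of the product are read as combinations of the rows of \<open>N\<close>,
  with the entries of a row of \<open>M\<close> as coefficients, and the triangle inequality
  applies.\<close>

lemma norm_2_inf_mult_le_norm_inf:
  fixes M :: "real^'m^'n" and N :: "real^'k^'m"
  shows "norm_2_inf (M ** N) \<le> norm_inf M * norm_2_inf N"
proof (rule norm_2_inf_le)
  fix i
  have "row i (M ** N) = (\<Sum>j\<in>UNIV. M $ i $ j *\<^sub>R row j N)"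
    by (simp add: row_def vec_eq_iff matrix_matrix_mult_def)
  also have "norm \<dots> \<le> (\<Sum>j\<in>UNIV. \<bar>M $ i $ j\<bar> * norm_2_inf N)"
    by (intro sum_norm_le) (simp add: mult_left_mono norm_row_le_norm_2_inf)
  also have "\<dots> = (\<Sum>j\<in>UNIV. \<bar>M $ i $ j\<bar>) * norm_2_inf N"
    by (simp add: sum_distrib_right)
  also have "\<dots> \<le> norm_inf M * norm_2_inf N"
    unfolding norm_inf_def by (intro mult_right_mono Max_ge norm_2_inf_nonneg) auto
  finally show "norm (row i (M ** N)) \<le> norm_inf M * norm_2_inf N" .
qed

lemma dist_2_inf_le:
  fixes U W :: "real^'r^'n"
  assumes "X \<in> orthonormal_mats"
  shows "dist_2_inf U W \<le> norm_2_inf (U - W ** X)"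
  unfolding dist_2_inf_def
  by (rule cINF_lower[OF _ assms]) (auto intro!: bdd_belowI2[where m=0] norm_2_inf_nonneg)

lemma norm_orthonormal_mult:
  assumes "U \<in> (orthonormal_mats :: (real^'r^'n) set)"
  shows "norm (U *v x) = norm x"
proof -
  have "(U *v x) \<bullet> (U *v x) = x \<bullet> x"
    using assms by (simp add: inner_matrix_vector_transpose matrix_vector_mul_assoc orthonormal_mats_def)
  then show ?thesis by (simp add: norm_eq)
qed

subsection \<open>Polar decomposition\<close>

lemma square_orthonormal_mats_iff:
  fixes X :: "real^'r^'r"
  shows "X \<in> orthonormal_mats \<longleftrightarrow> orthogonal_matrix X"
  by (simp add: orthonormal_mats_def orthogonal_matrix)

text \<open>Compactness supplies the maximiser of the trace from which the polar factor is obtained.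
  Unit rows give boundedness, and the defining equation is closed.\<close>

lemma compact_orthogonal_matrices: "compact {X :: real^'r^'r. orthogonal_matrix X}"
proof -
  have "norm X \<le> (\<Sum>i\<in>(UNIV::'r set). 1)" if "orthogonal_matrix X" for X :: "real^'r^'r"
  proof -
    have "norm (X $ i) = 1" for i
      using that by (metis orthogonal_matrix_orthonormal_rows row_def vec_nth_inverse)
    then show ?thesis
      using norm_le_l1_cart order_trans norm_vec_def L2_set_le_sum[of UNIV "\<lambda>i. norm (X $ i)"]
      by (simp add: norm_vec_def)
  qed
  then have "bounded {X :: real^'r^'r. orthogonal_matrix X}"
    by (auto simp: bounded_iff)
  moreover have "continuous_on UNIV (\<lambda>X :: real^'r^'r. transpose X ** X)"
    unfolding matrix_matrix_mult_def transpose_def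
    by (intro continuous_intros)
  then have "closed {X :: real^'r^'r. transpose X ** X = mat 1}"
    by (intro closed_Collect_eq continuous_intros)
  ultimately show ?thesis
    by (simp add: compact_eq_bounded_closed orthogonal_matrix)
qed

lemma trace_eq_inner_axis:
  fixes M :: "real^'r^'r"
  shows "trace M = (\<Sum>i\<in>UNIV. axis i 1 \<bullet> (M *v axis i 1))"
  by (simp add: trace_def inner_axis' matrix_vector_mult_basis column_def)

lemma sum_axis_bilinear:
  fixes S :: "real^'r^'r"
  shows "(\<Sum>i\<in>UNIV. (a \<bullet> (S *v axis i 1)) * b $ i) = a \<bullet> (S *v b)"
proof -
  have "S *v b = (\<Sum>i\<in>UNIV. b $ i *\<^sub>R (S *v axis i 1))"
    by (subst matrix_mult_sum) (simp add: matrix_vector_mult_basis scalar_mult_eq_scaleR)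
  then show ?thesis by (simp add: inner_sum_right mult.commute)
qed

text \<open>The Householder reflection in the hyperplane orthogonal to \<open>u\<close>. For
  \<open>u = 0\<close> division by zero yields 0, so the matrix is the identity.\<close>

definition reflection :: "real^'r \<Rightarrow> real^'r^'r"
  where "reflection u = (\<chi> i j. (if i = j then 1 else 0) - 2 * u $ i * u $ j / (u \<bullet> u))"

lemma reflection_mult_vector: "reflection u *v x = x - (2 * (u \<bullet> x) / (u \<bullet> u)) *\<^sub>R u"
proof -
  have "(reflection u *v x) $ i = x $ i - 2 * (u \<bullet> x) / (u \<bullet> u) * u $ i" for i
  proof -
    have "(reflection u *v x) $ i
        = (\<Sum>j\<in>UNIV. (if i = j then x $ j else 0) - 2 * u $ i / (u \<bullet> u) * (u $ j * x $ j))"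
      unfolding matrix_vector_mult_def reflection_def
      by (auto intro!: sum.cong simp: algebra_simps)
    also have "\<dots> = x $ i - 2 * u $ i / (u \<bullet> u) * (u \<bullet> x)"
      by (simp add: sum_subtractf inner_vec_def flip: sum_distrib_left sum_divide_distrib)
    finally show ?thesis by simp
  qed
  then show ?thesis by (simp add: vec_eq_iff)
qed

lemma orthogonal_matrix_reflection: "orthogonal_matrix (reflection u)"
proof -
  have "transpose (reflection u) = reflection u"
    by (simp add: reflection_def transpose_def vec_eq_iff mult_ac)
  moreover have "reflection u *v (reflection u *v x) = x" for x
    by (cases "u = 0") (simp_all add: reflection_mult_vector inner_diff_right)
  then have "reflection u ** reflection u = mat 1"
    by (simp add: matrix_eq matrix_vector_mul_assoc)
  ultimately show ?thesis
    by (simp add: orthogonal_matrix)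
qed

text \<open>The reflection differs from the identity by a multiple of the outer product of
  \<open>u\<close> with itself, and the trace of that outer product times \<open>T\<close> is
  \<open>u \<bullet> (T *v u)\<close>.\<close>

lemma trace_reflection_mult:
  "trace (reflection u ** T) = trace T - 2 * (u \<bullet> (T *v u)) / (u \<bullet> u)"
proof -
  have "trace (reflection u ** T)
      = (\<Sum>i\<in>UNIV. axis i 1 \<bullet> (T *v axis i 1) - 2 / (u \<bullet> u) * ((u \<bullet> (T *v axis i 1)) * u $ i))"
    unfolding trace_eq_inner_axis
    by (intro sum.cong refl)
      (simp add: matrix_vector_mul_assoc[symmetric] reflection_mult_vector inner_diff_right inner_axis')
  then show ?thesis
    by (simp add: sum_subtractf trace_eq_inner_axis sum_axis_bilinear flip: sum_distrib_left sum_divide_distrib)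
qed

text \<open>First-order optimality: \<open>e\<close> takes both signs, and for small
  \<open>e\<close> the linear term would dominate.\<close>

lemma eq_0_if_linear_le_quadratic:
  fixes a b :: real
  assumes "\<And>e. e * a \<le> e\<^sup>2 * b"
  shows "a = 0"
proof (rule ccontr)
  assume "a \<noteq> 0"
  \<comment> \<open>Any positive \<open>c\<close> above \<open>b\<close> works:
    \<open>e = a / c\<close> turns the hypothesis into
    \<open>a\<^sup>2 * c \<le> a\<^sup>2 * b\<close>.\<close>
  define c where "c = \<bar>b\<bar> + 1"
  have c: "c > 0" "b < c" by (auto simp: c_def)
  have "a / c * a \<le> (a / c)\<^sup>2 * b" by (rule assms)
  then have "a\<^sup>2 * c \<le> a\<^sup>2 * b"
    using c by (simp add: power2_eq_square field_simps)
  then show False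
    using c \<open>a \<noteq> 0\<close> by (simp add: mult_le_cancel_left)
qed

text \<open>
  Reflections test a maximiser of the trace for positivity, products of two reflections
  test it for symmetry.
\<close>

lemma trace_maximal_symmetric_psd:
  fixes S :: "real^'r^'r"
  assumes max: "\<And>W. orthogonal_matrix W \<Longrightarrow> trace (W ** S) \<le> trace S"
  shows "0 \<le> x \<bullet> (S *v x)" and "transpose S = S"
proof -
  have psd: "0 \<le> x \<bullet> (S *v x)" for x
  proof (cases "x = 0")
    case False
    then have "0 < x \<bullet> x" by simp
    moreover have "0 \<le> 2 * (x \<bullet> (S *v x)) / (x \<bullet> x)"
      using max[OF orthogonal_matrix_reflection[of x]] unfolding trace_reflection_mult by linarith
    ultimately show ?thesis by (auto simp: zero_le_divide_iff dest: leD)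
  qed simp
  then show "0 \<le> x \<bullet> (S *v x)" .
  \<comment> \<open>The trace formula is used twice, and the inequality is cleared of denominators.
    Only the mixed term on the left sees \<open>S\<close> off its quadratic form, and it is not
    symmetric in \<open>u\<close> and \<open>w\<close>.\<close>
  have two: "2 * (u \<bullet> w) * (w \<bullet> (S *v u)) \<le> (w \<bullet> w) * (u \<bullet> (S *v u)) + (u \<bullet> u) * (w \<bullet> (S *v w))"
    if "u \<noteq> 0" "w \<noteq> 0" for u w
  proof -
    have "trace (reflection u ** (reflection w ** S)) \<le> trace S"
      using max[OF orthogonal_matrix_mul[OF orthogonal_matrix_reflection orthogonal_matrix_reflection]]
      by (simp add: matrix_mul_assoc)
    then have "4 * ((u \<bullet> w) * (w \<bullet> (S *v u))) / ((u \<bullet> u) * (w \<bullet> w))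
        - 2 * (u \<bullet> (S *v u)) / (u \<bullet> u) \<le> 2 * (w \<bullet> (S *v w)) / (w \<bullet> w)"
      by (simp add: trace_reflection_mult matrix_vector_mul_assoc[symmetric] reflection_mult_vector
          inner_diff_right diff_divide_distrib right_diff_distrib mult_ac)
    moreover have "0 < u \<bullet> u" "0 < w \<bullet> w" using that by auto
    ultimately show ?thesis
      by (simp add: field_simps)
  qed
  have sym: "x \<bullet> (S *v u) = u \<bullet> (S *v x)" if "u \<bullet> x = 0" "u \<noteq> 0" for u x
  proof -
    have U: "u \<bullet> u > 0" using that by simp
    have "e * (x \<bullet> (S *v u) - u \<bullet> (S *v x))
        \<le> e\<^sup>2 * (((x \<bullet> x) * (u \<bullet> (S *v u)) + (u \<bullet> u) * (x \<bullet> (S *v x))) / (u \<bullet> u))" for e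
    proof -
      \<comment> \<open>A small tilt of \<open>u\<close> towards the orthogonal \<open>x\<close>:
        the product of the two reflections is then a rotation near the identity, and its first-order
        effect on the trace is the antisymmetric part of \<open>S\<close>.\<close>
      define w where "w = u + e *\<^sub>R x"
      have "u \<bullet> w = u \<bullet> u" by (simp add: w_def inner_add_right that)
      then have "w \<noteq> 0" using U by auto
      have ww: "w \<bullet> w = u \<bullet> u + e\<^sup>2 * (x \<bullet> x)"
        using that by (simp add: w_def inner_add_left inner_add_right inner_commute power2_eq_square)
      have wSu: "w \<bullet> (S *v u) = u \<bullet> (S *v u) + e * (x \<bullet> (S *v u))"
        by (simp add: w_def inner_add_left)
      have wSw: "w \<bullet> (S *v w)
          = u \<bullet> (S *v u) + e * (x \<bullet> (S *v u)) + e * (u \<bullet> (S *v x)) + e\<^sup>2 * (x \<bullet> (S *v x))"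
        by (simp add: w_def inner_add_left inner_add_right matrix_vector_right_distrib
            matrix_vector_mult_scaleR algebra_simps power2_eq_square)
      have "(e * (x \<bullet> (S *v u) - u \<bullet> (S *v x))) * (u \<bullet> u)
          \<le> e\<^sup>2 * ((x \<bullet> x) * (u \<bullet> (S *v u)) + (u \<bullet> u) * (x \<bullet> (S *v x)))"
        using two[OF \<open>u \<noteq> 0\<close> \<open>w \<noteq> 0\<close>] unfolding \<open>u \<bullet> w = u \<bullet> u\<close> ww wSu wSw
        by (simp add: algebra_simps)
      then show ?thesis using U by (simp add: pos_le_divide_eq)
    qed
    from eq_0_if_linear_le_quadratic[OF this] show ?thesis by simp
  qed
  \<comment> \<open>Distinct coordinate axes are orthogonal, so \<open>sym\<close> reaches every
    off-diagonal entry.\<close>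
  have "S $ j $ i = S $ i $ j" for i j
  proof (cases "i = j")
    case False
    then show ?thesis
      using sym[of "axis i 1" "axis j 1"]
      by (simp add: inner_axis' matrix_vector_mult_basis column_def axis_eq_0_iff) (simp add: axis_def)
  qed simp
  then show "transpose S = S" by (simp add: transpose_def vec_eq_iff)
qed

text \<open>\<open>X\<close> maximises the trace of \<open>transpose X ** M\<close> over the
  orthogonal group. For orthogonal \<open>W\<close> the competitor \<open>X ** transpose W\<close>
  shows that multiplying by \<open>W\<close> cannot increase the trace, which is the criterion of
  \<open>trace_maximal_symmetric_psd\<close>.\<close>

lemma polar_factor_exists:
  fixes M :: "real^'r^'r"
  obtains X where "orthogonal_matrix X" "transpose (transpose X ** M) = transpose X ** M"
    "\<And>x. 0 \<le> x \<bullet> ((transpose X ** M) *v x)"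
proof -
  have "continuous_on {X. orthogonal_matrix X} (\<lambda>X. trace (transpose X ** M))"
    unfolding trace_def matrix_matrix_mult_def transpose_def
    by (intro continuous_intros)
  then obtain X where X: "orthogonal_matrix X"
    and max: "\<And>Y. orthogonal_matrix Y \<Longrightarrow> trace (transpose Y ** M) \<le> trace (transpose X ** M)"
    using continuous_attains_sup[OF compact_orthogonal_matrices] orthogonal_matrix_id by blast
  have "trace (W ** (transpose X ** M)) \<le> trace (transpose X ** M)" if "orthogonal_matrix W" for W
    using max[of "X ** transpose W"] X that
    by (simp add: orthogonal_matrix_mul matrix_transpose_mul matrix_mul_assoc)
  from trace_maximal_symmetric_psd[OF this] X that show ?thesis by blast
qed

text \<open>
  With \<open>S = X\<^sup>T M\<close> symmetric positive semidefinite, \<open>(I - S)(I + S) = I - M\<^sup>T M = N\<^sup>T N\<close>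
  and \<open>(I + S)\<^sup>-\<^sup>1\<close> is a contraction.
\<close>

lemma near_orthogonal_matrix:
  fixes M :: "real^'r^'r" and N :: "real^'r^'s"
  assumes MN: "transpose M ** M + transpose N ** N = mat 1"
  obtains X where "X \<in> orthonormal_mats" "spectral_norm (M - X) \<le> (spectral_norm N)\<^sup>2"
proof -
  obtain X where X: "orthogonal_matrix X" and sym: "transpose (transpose X ** M) = transpose X ** M"
    and psd: "\<And>x. 0 \<le> x \<bullet> ((transpose X ** M) *v x)"
    by (rule polar_factor_exists[of M]) blast
  define S where "S = transpose X ** M"
  have XX: "transpose X ** X = mat 1" "X ** transpose X = mat 1"
    using X by (auto simp: orthogonal_matrix_def)
  have M: "M = X ** S"
    by (simp add: S_def matrix_mul_assoc XX)
  have SS: "S ** S = transpose M ** M"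
  proof -
    have "S ** S = transpose S ** S" using sym by (simp add: S_def)
    also have "\<dots> = transpose M ** (X ** transpose X) ** M"
      by (simp add: S_def matrix_transpose_mul matrix_mul_assoc)
    finally show ?thesis by (simp add: XX)
  qed
  have "norm ((M - X) *v y) \<le> (spectral_norm N)\<^sup>2 * norm y" for y
  proof -
    \<comment> \<open>This gives both the invertibility of \<open>mat 1 + S\<close> and the
      contraction property of its inverse.\<close>
    have expand: "norm z \<le> norm ((mat 1 + S) *v z)" for z
    proof -
      have "norm z * norm z \<le> z \<bullet> ((mat 1 + S) *v z)"
        using psd[of z] by (simp add: S_def matrix_vector_mult_add_rdistrib inner_add_right
            dot_square_norm power2_eq_square)
      also have "\<dots> \<le> norm z * norm ((mat 1 + S) *v z)" by (rule norm_cauchy_schwarz)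
      finally show ?thesis by (cases "z = 0") (auto simp: mult_le_cancel_left)
    qed
    have "inj ((*v) (mat 1 + S))"
    proof (rule injI)
      fix a b assume "(mat 1 + S) *v a = (mat 1 + S) *v b"
      then show "a = b" using expand[of "a - b"] by (simp add: matrix_vector_mult_diff_distrib)
    qed
    then have "surj ((*v) (mat 1 + S))"
      by (simp add: linear_injective_imp_surjective)
    \<comment> \<open>Writing \<open>y\<close> in this form turns \<open>y - S *v y\<close> into
      \<open>z - S *v (S *v z)\<close>, where \<open>MN\<close> applies.\<close>
    then obtain z where z: "y = (mat 1 + S) *v z" by (metis surjD)
    have "S *v (S *v z) = z - transpose N *v (N *v z)"
      using MN by (simp add: matrix_vector_mul_assoc SS eq_diff_eq matrix_vector_mult_add_rdistrib[symmetric])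
    then have "y - S *v y = transpose N *v (N *v z)"
      by (simp add: z matrix_vector_mult_add_rdistrib matrix_vector_right_distrib)
    then have "norm (y - S *v y) \<le> spectral_norm N * norm (N *v z)"
      using norm_le_spectral_norm[of "transpose N" "N *v z"] by (simp add: spectral_norm_transpose)
    also have "\<dots> \<le> spectral_norm N * (spectral_norm N * norm z)"
      by (intro mult_left_mono norm_le_spectral_norm spectral_norm_nonneg)
    also have "\<dots> \<le> spectral_norm N * (spectral_norm N * norm y)"
      using expand[of z] by (intro mult_left_mono spectral_norm_nonneg) (simp add: z)
    finally have "norm (y - S *v y) \<le> (spectral_norm N)\<^sup>2 * norm y"
      by (simp add: power2_eq_square mult_ac)
    moreover have "(M - X) *v y = X *v (S *v y - y)"
      unfolding M by (simp add: matrix_vector_mult_diff_rdistrib matrix_vector_mult_diff_distrib matrix_vector_mul_assoc)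
    ultimately show ?thesis
      using X by (simp add: norm_orthonormal_mult square_orthonormal_mats_iff norm_minus_commute)
  qed
  then have "spectral_norm (M - X) \<le> (spectral_norm N)\<^sup>2" by (rule spectral_norm_le)
  with X that show ?thesis by (simp add: square_orthonormal_mats_iff)
qed

subsection \<open>Distances between subspaces\<close>

text \<open>A lower bound forces injectivity, hence invertibility of a square matrix. The same bound
  at \<open>H *v y\<close> controls the inverse.\<close>

lemma bounded_below_inverse:
  fixes G :: "real^'r^'r"
  assumes "0 < c" and below: "\<And>y. c * norm y \<le> norm (G *v y)"
  obtains H where "G ** H = mat 1" "H ** G = mat 1" "spectral_norm H \<le> 1 / c"
proof -
  have "inj ((*v) G)"
  proof (rule injI)
    fix a b assume "G *v a = G *v b"
    then have "c * norm (a - b) \<le> 0"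
      using below[of "a - b"] by (simp add: matrix_vector_mult_diff_distrib)
    with \<open>0 < c\<close> show "a = b" by (simp add: mult_le_0_iff)
  qed
  then obtain H where H: "H ** G = mat 1" by (metis matrix_left_invertible_injective)
  then have G: "G ** H = mat 1" by (simp add: matrix_left_right_inverse)
  have "spectral_norm H \<le> 1 / c"
  proof (rule spectral_norm_le)
    fix y
    have "c * norm (H *v y) \<le> norm y"
      using below[of "H *v y"] by (simp add: matrix_vector_mul_assoc G)
    then show "norm (H *v y) \<le> 1 / c * norm y"
      using \<open>0 < c\<close> by (simp add: field_simps)
  qed
  with G H that show ?thesis by blast
qed

lemma norm_sq_complement:
  fixes V :: "real^'r^'n" and W :: "real^'s^'n"
  assumes "V ** transpose V + W ** transpose W = mat 1"
  shows "(norm (transpose V *v x))\<^sup>2 + (norm (transpose W *v x))\<^sup>2 = (norm x)\<^sup>2"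
proof -
  have "x \<bullet> x = x \<bullet> ((V ** transpose V + W ** transpose W) *v x)"
    by (simp add: assms)
  also have "\<dots> = (transpose V *v x) \<bullet> (transpose V *v x) + (transpose W *v x) \<bullet> (transpose W *v x)"
    unfolding inner_matrix_vector_transpose
    by (simp add: matrix_vector_mult_add_rdistrib inner_add_right matrix_vector_mul_assoc[symmetric]
        del: transpose_matrix_vector)
  finally show ?thesis by (simp add: power2_norm_eq_inner)
qed

text \<open>If \<open>spectral_norm (transpose U ** W)\<close> is the sine of the largest principal
  angle, this is the bound by its cosine. It follows from Pythagoras for
  \<open>U *v y\<close>.\<close>

lemma inner_subspace_below:
  fixes U V :: "real^'r^'n" and W :: "real^'s^'n"
  assumes U: "U \<in> orthonormal_mats" and VW: "V ** transpose V + W ** transpose W = mat 1"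
  shows "(1 - (spectral_norm (transpose U ** W))\<^sup>2) * (norm y)\<^sup>2 \<le> (norm (transpose V *v (U *v y)))\<^sup>2"
proof -
  have "norm (transpose W *v (U *v y)) \<le> spectral_norm (transpose U ** W) * norm y"
    using norm_le_spectral_norm[of "transpose (transpose U ** W)" y]
    unfolding spectral_norm_transpose
    by (simp add: matrix_transpose_mul matrix_vector_mul_assoc del: transpose_matrix_vector)
  then have "(norm (transpose W *v (U *v y)))\<^sup>2 \<le> (spectral_norm (transpose U ** W) * norm y)\<^sup>2"
    by (intro power_mono) auto
  then show ?thesis
    using norm_sq_complement[OF VW, of "U *v y"] norm_orthonormal_mult[OF U, of y]
    by (simp add: left_diff_distrib power_mult_distrib del: transpose_matrix_vector)
qed

text \<open>For the upper bound the difference of the projections maps \<open>x\<close> to two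
  orthogonal pieces, one in the range of \<open>U\<close> and one orthogonal to it. They are bounded
  by the components of \<open>x\<close> along \<open>W\<close> and along \<open>V\<close>
  respectively. The lower bound comes from vectors in the range of \<open>W\<close>.\<close>

lemma dist_2_eq_spectral_norm:
  fixes U V :: "real^'r^'n" and W :: "real^'s^'n"
  assumes U: "U \<in> orthonormal_mats" and V: "V \<in> orthonormal_mats" and W: "W \<in> orthonormal_mats"
    and VW: "V ** transpose V + W ** transpose W = mat 1"
    and less1: "spectral_norm (transpose U ** W) < 1"
  shows "dist_2 U V = spectral_norm (transpose U ** W)"
proof -
  define d where "d = spectral_norm (transpose U ** W)"
  define c where "c = sqrt (1 - d\<^sup>2)"
  have d: "0 \<le> d" "d < 1" using less1 by (auto simp: d_def spectral_norm_nonneg)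
  then have "d\<^sup>2 < 1" by (simp add: power_less_one_iff abs_square_less_1)
  then have c: "0 < c" "c\<^sup>2 = 1 - d\<^sup>2" by (auto simp: c_def)
  have UU: "transpose U ** U = mat 1" and VV: "transpose V ** V = mat 1"
    and WW: "transpose W ** W = mat 1"
    using U V W by (auto simp: orthonormal_mats_def)
  have VW0: "transpose V ** W = 0"
  proof -
    have "W = (V ** transpose V + W ** transpose W) ** W" by (simp add: VW)
    also have "\<dots> = V ** (transpose V ** W) + W"
      by (simp add: matrix_mult_add_rdistrib WW flip: matrix_mul_assoc)
    finally have "V ** (transpose V ** W) = 0" by simp
    then have "transpose V ** V ** (transpose V ** W) = 0" by (simp flip: matrix_mul_assoc)
    then show ?thesis by (simp add: VV)
  qed
  have "c * norm y \<le> norm (transpose V *v (U *v y))" for y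
  proof (rule power2_le_imp_le)
    show "(c * norm y)\<^sup>2 \<le> (norm (transpose V *v (U *v y)))\<^sup>2"
      using inner_subspace_below[OF U VW, of y] unfolding power_mult_distrib c(2) d_def .
  qed simp
  then obtain H where H: "(transpose V ** U) ** H = mat 1" "spectral_norm H \<le> 1 / c"
    using bounded_below_inverse[of c "transpose V ** U"] c(1)
    unfolding matrix_vector_mul_assoc by blast
  have HUV: "transpose H ** (transpose U ** V) = mat 1"
    using arg_cong[OF H(1), of transpose] by (simp add: matrix_transpose_mul transpose_mat)
  \<comment> \<open>The lower bound passes from \<open>transpose V ** U\<close> to its transpose:
    the matrix is square, and the transposed inverse has the same norm.\<close>
  have below: "(1 - d\<^sup>2) * (norm a)\<^sup>2 \<le> (norm ((transpose U ** V) *v a))\<^sup>2" for a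
  proof -
    have "norm a = norm (transpose H *v ((transpose U ** V) *v a))"
      by (simp add: matrix_vector_mul_assoc HUV del: transpose_matrix_vector)
    also have "\<dots> \<le> spectral_norm H * norm ((transpose U ** V) *v a)"
      using norm_le_spectral_norm[of "transpose H"] by (metis spectral_norm_transpose)
    also have "\<dots> \<le> 1 / c * norm ((transpose U ** V) *v a)"
      using H(2) by (intro mult_right_mono) auto
    finally have "c * norm a \<le> norm ((transpose U ** V) *v a)"
      using c by (simp add: field_simps)
    then have "(c * norm a)\<^sup>2 \<le> (norm ((transpose U ** V) *v a))\<^sup>2"
      using c by (intro power_mono) auto
    then show ?thesis using c by (simp add: power_mult_distrib)
  qed
  let ?D = "U ** transpose U - V ** transpose V"
  have "spectral_norm ?D \<le> d"
  proof (rule spectral_norm_le)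
    fix x
    define a b where "a = transpose V *v x" and "b = transpose W *v x"
    define p where "p = (transpose U ** W) *v b"
    define q where "q = V *v a - U *v ((transpose U ** V) *v a)"
    have ab: "(norm a)\<^sup>2 + (norm b)\<^sup>2 = (norm x)\<^sup>2"
      unfolding a_def b_def by (rule norm_sq_complement[OF VW])
    have x: "x = V *v a + W *v b"
      using arg_cong[OF VW, of "\<lambda>M. M *v x"]
      by (simp add: a_def b_def matrix_vector_mult_add_rdistrib matrix_vector_mul_assoc
          del: transpose_matrix_vector)
    have Va: "V *v a = (V ** transpose V) *v x"
      by (simp add: a_def matrix_vector_mul_assoc del: transpose_matrix_vector)
    have "?D *v x = U *v (transpose U *v x) - V *v a"
      unfolding Va by (simp add: matrix_vector_mult_diff_rdistrib matrix_vector_mul_assoc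
          del: transpose_matrix_vector)
    also have "\<dots> = U *v p - q"
      unfolding p_def q_def by (subst x)
        (simp add: matrix_vector_right_distrib matrix_vector_mul_assoc matrix_mul_assoc
          del: transpose_matrix_vector)
    finally have D: "?D *v x = U *v p - q" .
    have Uq: "transpose U *v q = 0"
      unfolding q_def by (simp add: matrix_vector_mult_diff_distrib matrix_vector_mul_assoc
          matrix_mul_assoc UU del: transpose_matrix_vector)
    then have "(U *v p) \<bullet> q = 0" by (simp only: inner_matrix_vector_transpose inner_zero_right)
    then have "(norm (?D *v x))\<^sup>2 = (norm p)\<^sup>2 + (norm q)\<^sup>2"
      unfolding D by (simp add: power2_norm_eq_inner inner_diff_left inner_diff_right inner_commute)
        (simp add: norm_orthonormal_mult[OF U] flip: power2_norm_eq_inner)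
    also have "(norm p)\<^sup>2 \<le> (d * norm b)\<^sup>2"
      unfolding p_def d_def by (intro power_mono norm_le_spectral_norm) simp
    \<comment> \<open>\<open>q\<close> is the part of \<open>V *v a\<close> orthogonal to the range
      of \<open>U\<close>, so Pythagoras expresses its norm through \<open>norm a\<close> and
      \<open>norm e\<close>, and \<open>below\<close> applies.\<close>
    also have "(norm q)\<^sup>2 \<le> (d * norm a)\<^sup>2"
    proof -
      define e where "e = (transpose U ** V) *v a"
      have "V *v a = U *v e + q" by (simp add: q_def e_def)
      then have "(norm (V *v a))\<^sup>2 = (norm (U *v e))\<^sup>2 + 2 * ((U *v e) \<bullet> q) + (norm q)\<^sup>2"
        by (simp add: power2_norm_eq_inner inner_add_left inner_add_right inner_commute)
      moreover have "(U *v e) \<bullet> q = 0"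
        using Uq by (simp only: inner_matrix_vector_transpose inner_zero_right)
      ultimately have "(norm q)\<^sup>2 = (norm a)\<^sup>2 - (norm e)\<^sup>2"
        by (simp add: norm_orthonormal_mult[OF U] norm_orthonormal_mult[OF V])
      then show ?thesis
        using below[of a] by (simp add: e_def power_mult_distrib algebra_simps)
    qed
    finally have "(norm (?D *v x))\<^sup>2 \<le> (d * norm x)\<^sup>2"
      by (simp add: power_mult_distrib distrib_left flip: ab)
    then show "norm (?D *v x) \<le> d * norm x"
      by (rule power2_le_imp_le) (simp add: d)
  qed
  moreover have "d \<le> spectral_norm ?D"
    unfolding d_def
  proof (rule spectral_norm_le)
    fix y
    have "?D *v (W *v y) = U *v ((transpose U ** W) *v y)"
      by (simp add: matrix_vector_mul_assoc matrix_mult_diff_rdistrib VW0 flip: matrix_mul_assoc)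
    then show "norm ((transpose U ** W) *v y) \<le> spectral_norm ?D * norm y"
      using norm_le_spectral_norm[of ?D "W *v y"]
      by (simp add: norm_orthonormal_mult[OF U] norm_orthonormal_mult[OF W])
  qed
  ultimately show ?thesis by (simp add: dist_2_def d_def)
qed

lemma norm_2_inf_orthonormal_pos:
  fixes V :: "real^'r^'n"
  assumes "V \<in> orthonormal_mats"
  shows "0 < norm_2_inf V"
proof (rule ccontr)
  assume "\<not> 0 < norm_2_inf V"
  then have "norm (row i V) \<le> 0" for i
    using norm_row_le_norm_2_inf[of i V] by linarith
  then have "V = 0" by (simp add: row_def vec_eq_iff)
  then have "norm (axis undefined 1 :: real^'r) = 0"
    using norm_orthonormal_mult[OF assms, of "axis undefined 1"] by simp
  then show False by simp
qed

text \<open>The admissible values form a closed half-line whose left end is positive by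
  \<open>norm_2_inf_orthonormal_pos\<close>, so the least one exists and gives equality.\<close>

lemma coherence_mult_sqrt:
  fixes V :: "real^'r^'n"
  assumes "V \<in> orthonormal_mats"
  shows "coherence V * sqrt (real CARD('r) / real CARD('n)) = norm_2_inf V"
proof -
  let ?s = "sqrt (real CARD('r) / real CARD('n))"
  have s: "0 < ?s" by simp
  have "coherence V = norm_2_inf V / ?s"
    unfolding coherence_def
    by (rule Least_equality)
      (use s norm_2_inf_orthonormal_pos[OF assms] in \<open>auto simp only: pos_divide_le_eq divide_pos_pos nonzero_divide_eq_eq\<close>, auto)
  then show ?thesis using s by simp
qed

subsection \<open>Orthonormal eigenbases\<close>

text \<open>For orthonormal vectors this is the orthogonal projection onto their span. Indexing by a
  set of numbers allows parts of the basis of any size without a type for their dimension.\<close>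

definition proj :: "(nat \<Rightarrow> real^'n) \<Rightarrow> nat set \<Rightarrow> real^'n^'n"
  where "proj v K = (\<chi> i j. \<Sum>k\<in>K. v k $ i * v k $ j)"

lemma proj_mult_vector: "proj v K *v x = (\<Sum>k\<in>K. (v k \<bullet> x) *\<^sub>R v k)"
proof -
  have "(proj v K *v x) $ i = (\<Sum>k\<in>K. (v k \<bullet> x) *\<^sub>R v k) $ i" for i
    unfolding proj_def matrix_vector_mult_def
    by (simp add: inner_vec_def sum_distrib_right sum_distrib_left mult_ac sum.swap[of _ K])
  then show ?thesis by (simp add: vec_eq_iff)
qed

lemma proj_Un_disjoint:
  assumes "finite K" "finite L" "K \<inter> L = {}"
  shows "proj v (K \<union> L) = proj v K + proj v L"
  using assms by (simp add: proj_def vec_eq_iff sum.union_disjoint)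

text \<open>\<open>pos\<close> is strictly increasing, hence a bijection onto an initial range. Sums
  over columns thereby become sums over intervals of numbers.\<close>

lemma pos_image: "pos ` (UNIV :: 'k::{finite,linorder} set) = {1..CARD('k)}" and inj_pos: "inj (pos :: 'k \<Rightarrow> nat)"
proof -
  have mono: "pos i < pos j" if "i < j" for i j :: 'k
    unfolding pos_def using that by (intro psubset_card_mono) auto
  then show "inj (pos :: 'k \<Rightarrow> nat)"
    by (metis injI less_irrefl linorder_neqE)
  then have "card (pos ` (UNIV :: 'k set)) = CARD('k)" by (rule card_image)
  moreover have "pos ` (UNIV :: 'k set) \<subseteq> {1..CARD('k)}"
    by (auto simp: pos_def Suc_le_eq card_gt_0_iff intro!: card_mono)
  ultimately show "pos ` (UNIV :: 'k set) = {1..CARD('k)}"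
    by (intro card_subset_eq) auto
qed

lemma sum_pos:
  "(\<Sum>j\<in>(UNIV :: 'k::{finite,linorder} set). f (s + pos j)) = sum f {s + 1..s + CARD('k)}"
proof -
  have "(\<Sum>j\<in>(UNIV :: 'k set). f (s + pos j)) = sum (\<lambda>i. f (s + i)) (pos ` (UNIV :: 'k set))"
    by (simp add: sum.reindex inj_pos o_def)
  also have "\<dots> = sum f ((+) s ` {1..CARD('k)})"
    by (subst sum.reindex) (auto simp: pos_image o_def)
  finally show ?thesis by (simp add: image_add_atLeastAtMost add.commute)
qed

lemma cols_from_mult_transpose:
  "(cols_from s v :: real^'k::{finite,linorder}^'n) ** transpose (cols_from s v)
    = proj v {s + 1..s + CARD('k)}"
  by (simp add: matrix_matrix_mult_def proj_def vec_eq_iff transpose_def cols_from_def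
      sum_pos[of "\<lambda>k. v k $ _ * v k $ _"])

lemma transpose_cols_from_mult_vector:
  "transpose (cols_from s v) *v x = (\<chi> j. v (s + pos j) \<bullet> x)"
  unfolding matrix_vector_mult_def by (simp add: transpose_def cols_from_def inner_vec_def)

lemma norm_transpose_cols_from:
  "(norm (transpose (cols_from s v :: real^'k::{finite,linorder}^'n) *v x))\<^sup>2
    = (\<Sum>k\<in>{s + 1..s + CARD('k)}. (v k \<bullet> x)\<^sup>2)"
  unfolding transpose_cols_from_mult_vector
  by (simp add: norm_vec_def L2_set_def sum_nonneg sum_pos[of "\<lambda>k. (v k \<bullet> x)\<^sup>2"])

locale orthonormal_basis_seq =
  fixes v :: "nat \<Rightarrow> real^'n"
  assumes orthonormal:
    "\<lbrakk>i \<in> {1..CARD('n)}; j \<in> {1..CARD('n)}\<rbrakk> \<Longrightarrow> v i \<bullet> v j = (if i = j then 1 else 0)"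
begin

lemma norm_expansion:
  assumes "K \<subseteq> {1..CARD('n)}"
  shows "(norm (\<Sum>k\<in>K. a k *\<^sub>R v k))\<^sup>2 = (\<Sum>k\<in>K. (a k)\<^sup>2)"
proof -
  have "(norm (\<Sum>k\<in>K. a k *\<^sub>R v k))\<^sup>2 = (\<Sum>k\<in>K. (norm (a k *\<^sub>R v k))\<^sup>2)"
  proof (rule norm_sum_Pythagorean)
    show "finite K" using assms by (rule finite_subset) simp
    show "pairwise (\<lambda>i j. orthogonal (a i *\<^sub>R v i) (a j *\<^sub>R v j)) K"
      using assms by (auto simp: pairwise_def orthogonal_def orthonormal subset_iff)
  qed
  also have "\<dots> = (\<Sum>k\<in>K. (a k)\<^sup>2)"
    using assms by (intro sum.cong) (auto simp: power_mult_distrib power2_norm_eq_inner orthonormal subset_iff)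
  finally show ?thesis .
qed

lemma norm_proj_mult_vector:
  assumes "K \<subseteq> {1..CARD('n)}"
  shows "(norm (proj v K *v x))\<^sup>2 = (\<Sum>k\<in>K. (v k \<bullet> x)\<^sup>2)"
  by (simp add: proj_mult_vector norm_expansion[OF assms])

text \<open>Completeness of the basis: for a square matrix, orthonormal columns imply orthonormal
  rows.\<close>

lemma proj_all: "proj v {1..CARD('n)} = mat 1"
proof -
  \<comment> \<open>The row index type carries no order, so an arbitrary enumeration takes the place
    of \<open>pos\<close>.\<close>
  obtain f where f: "bij_betw f (UNIV :: 'n set) {1..CARD('n)}"
    using ex_bij_betw_nat_finite_1 bij_betw_inv by (metis finite)
  define W :: "real^'n^'n" where "W = (\<chi> i j. v (f j) $ i)"
  have "(transpose W ** W) $ i $ j = v (f i) \<bullet> v (f j)" for i j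
    by (simp add: W_def matrix_matrix_mult_def transpose_def inner_vec_def)
  also have "\<dots> i j = (if i = j then 1 else 0)" for i j
  proof -
    have "f i \<in> {1..CARD('n)}" "f j \<in> {1..CARD('n)}" "f i = f j \<longleftrightarrow> i = j"
      using f by (auto simp: bij_betw_def inj_on_def)
    then show ?thesis using orthonormal by presburger
  qed
  finally have "transpose W ** W = mat 1"
    by (simp add: vec_eq_iff mat_def)
  then have "W ** transpose W = mat 1" by (simp add: matrix_left_right_inverse)
  moreover have "W ** transpose W = proj v {1..CARD('n)}"
    unfolding proj_def sum.reindex_bij_betw[OF f, symmetric]
    by (simp add: W_def matrix_matrix_mult_def transpose_def)
  ultimately show ?thesis by simp
qed

lemma cols_from_orthonormal:
  assumes "s + CARD('k) \<le> CARD('n)"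
  shows "(cols_from s v :: real^'k::{finite,linorder}^'n) \<in> orthonormal_mats"
proof -
  have range: "s + pos j \<in> {1..CARD('n)}" for j :: "'k::{finite,linorder}"
  proof -
    have "pos j \<in> {1..CARD('k)}" using pos_image by blast
    then show ?thesis using assms by auto
  qed
  have "(transpose (cols_from s v :: real^'k::{finite,linorder}^'n) ** (cols_from s v :: real^'k::{finite,linorder}^'n)) $ i $ j = v (s + pos i) \<bullet> v (s + pos j)" for i j
    by (simp add: matrix_matrix_mult_def transpose_def cols_from_def inner_vec_def)
  then show ?thesis
    by (auto simp: orthonormal_mats_def vec_eq_iff mat_def orthonormal[OF range range]
        dest: injD[OF inj_pos])
qed

end

text \<open>The inner dimension \<open>'m\<close> of the outer product is arbitrary and contributes a factor \<open>CARD('m) \<ge> 1\<close>.\<close>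

lemma norm_inf_proj_le:
  fixes v :: "nat \<Rightarrow> real^'n"
  shows "norm_inf (proj v {k})
    \<le> norm_inf ((columnvector (v k) :: real^'m^'n) ** (rowvector (v k) :: real^'n^'m))"
proof -
  let ?B = "(columnvector (v k) :: real^'m^'n) ** (rowvector (v k) :: real^'n^'m)"
  have "\<bar>proj v {k} $ i $ j\<bar> \<le> \<bar>?B $ i $ j\<bar>" for i j
  proof -
    have "?B $ i $ j = real CARD('m) * (proj v {k} $ i $ j)"
      by (simp add: matrix_matrix_mult_def columnvector_def rowvector_def proj_def)
    moreover have "1 \<le> real CARD('m)" by (simp add: Suc_le_eq)
    ultimately show ?thesis
      using mult_right_mono[of 1 "real CARD('m)" "\<bar>proj v {k} $ i $ j\<bar>"] by (simp add: abs_mult)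
  qed
  then have "(\<Sum>j\<in>UNIV. \<bar>proj v {k} $ i $ j\<bar>) \<le> norm_inf ?B" for i
    unfolding norm_inf_def by (rule order_trans[OF sum_mono Max_ge]) auto
  then show ?thesis
    unfolding norm_inf_def[of "proj v {k}"] by (subst Max_le_iff) auto
qed

subsection \<open>Subspace iteration\<close>

text \<open>The witness is the product \<open>R\<^sub>t \<dots> R\<^sub>1\<close> of the triangular factors, so that \<open>A\<^sup>t Q\<^sub>0 = Q\<^sub>t R\<close>.\<close>

lemma subspace_iteration_coords:
  fixes A :: "real^'n^'n" and Q :: "nat \<Rightarrow> real^'r::{finite,linorder}^'n"
  assumes iter: "subspace_iteration A Q0 Q"
    and sym: "transpose A = A"
  obtains R where "\<And>v l z. A *v v = l *\<^sub>R v \<Longrightarrow> v \<bullet> (Q t *v (R *v z)) = l ^ t * (v \<bullet> (Q0 *v z))"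
proof -
  have "\<exists>R. \<forall>v l z. A *v v = l *\<^sub>R v \<longrightarrow> v \<bullet> (Q t *v (R *v z)) = l ^ t * (v \<bullet> (Q0 *v z))"
  proof (induction t)
    case 0
    then show ?case
      using iter by (intro exI[of _ "mat 1"]) (simp add: subspace_iteration_def)
  next
    case (Suc t)
    then obtain R where R: "\<And>v l z. A *v v = l *\<^sub>R v \<Longrightarrow> v \<bullet> (Q t *v (R *v z)) = l ^ t * (v \<bullet> (Q0 *v z))"
      by blast
    obtain R' where R': "A ** Q t = Q (Suc t) ** R'"
      using iter unfolding subspace_iteration_def by (metis diff_Suc_1 le_add1 plus_1_eq_Suc)
    have "v \<bullet> (Q (Suc t) *v ((R' ** R) *v z)) = l ^ Suc t * (v \<bullet> (Q0 *v z))" if "A *v v = l *\<^sub>R v" for v l z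
    proof -
      have "Q (Suc t) *v ((R' ** R) *v z) = A *v (Q t *v (R *v z))"
        by (simp add: matrix_vector_mul_assoc matrix_mul_assoc flip: R')
      \<comment> \<open>Symmetry moves \<open>A\<close> onto the eigenvector, which contributes one
        more factor \<open>l\<close>.\<close>
      then have "v \<bullet> (Q (Suc t) *v ((R' ** R) *v z)) = (A *v v) \<bullet> (Q t *v (R *v z))"
        by (metis inner_matrix_vector_transpose sym)
      also have "\<dots> = l ^ Suc t * (v \<bullet> (Q0 *v z))"
        using that R[OF that, of z] by simp
      finally show ?thesis .
    qed
    then show ?case by blast
  qed
  then show ?thesis using that by blast
qed

theorem proposition2:
  fixes A :: "real^'n^'n"
    and lam :: "nat \<Rightarrow> real"
    and v :: "nat \<Rightarrow> real^'n"
    and V :: "real^'r::{finite,linorder}^'n"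
    and Vperp :: "real^'s::{finite,linorder}^'n"
    and Q0 :: "real^'r::{finite,linorder}^'n"
    and Q :: "nat \<Rightarrow> real^'r::{finite,linorder}^'n"
    and n r t :: nat
    and \<mu> d0 :: real
  assumes "n = CARD('n)" and "r = CARD('r)" and "CARD('s) = n - r"
    and "r \<ge> 1" and "r + 2 \<le> n"
    and "transpose A = A"
    and "\<forall>k\<in>{1..<r}. lam k \<ge> lam (k + 1)"
    and "lam r > lam (r + 1)"
    and "\<forall>k\<in>{r+1..<n}. lam k \<ge> lam (k + 1)"
    and "(MIN k\<in>{1..r}. \<bar>lam k\<bar>) > (MAX k\<in>{r+1..n}. \<bar>lam k\<bar>)"
    and "\<forall>k\<in>{1..n}. A *v v k = lam k *\<^sub>R v k"
    and "\<forall>i\<in>{1..n}. \<forall>j\<in>{1..n}. v i \<bullet> v j = (if i = j then 1 else 0)"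
    and "V = cols_from 0 v"
    and "Vperp = cols_from r v"
    and "\<mu> = coherence V"
    and "Q0 \<in> orthonormal_mats"
    and "d0 = spectral_norm (transpose Q0 ** Vperp)"
    and "d0 < 1"
    and "subspace_iteration A Q0 Q"
  shows "d0 = dist_2 Q0 V \<and>
    dist_2_inf (Q t) V
      \<le> ((MAX k\<in>{r+1..n}. \<bar>lam k\<bar>) / lam r) ^ t
           * (\<mu> * sqrt (2 * real r / real n) * (d0 / sqrt (1 - d0\<^sup>2))
              + norm_inf (columnvector (v (r + 1)) ** rowvector (v (r + 1))) / sqrt (1 - d0\<^sup>2)
                * dist_2_inf Q0 V)
         + ((MAX k\<in>{r+2..n}. \<bar>lam k\<bar>) / lam r) ^ t * (d0 / sqrt (1 - d0\<^sup>2))"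
proof -
  have n: "CARD('n) = n" and r: "CARD('r) = r" and s: "CARD('s) = n - r"
    using assms(1-3) by simp_all
  interpret orthonormal_basis_seq v
    by unfold_locales (use assms(1,12) in auto)
  note transpose_matrix_vector [simp del]

  \<comment> \<open>Sizes and signs of the eigenvalues\<close>
  define L where "L = lam r"
  define m1 where "m1 = (MAX k\<in>{r+1..n}. \<bar>lam k\<bar>)"
  define m2 where "m2 = (MAX k\<in>{r+2..n}. \<bar>lam k\<bar>)"
  define c where "c = sqrt (1 - d0\<^sup>2)"
  have m1: "\<bar>lam k\<bar> \<le> m1" if "k \<in> {r+1..n}" for k
    unfolding m1_def using that by (intro Max_ge) auto
  have m2: "\<bar>lam k\<bar> \<le> m2" if "k \<in> {r+2..n}" for k
    unfolding m2_def using that by (intro Max_ge) auto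
  have m1_less: "m1 < \<bar>lam k\<bar>" if "k \<in> {1..r}" for k
    using assms(10) Min_le[of "(\<lambda>k. \<bar>lam k\<bar>) ` {1..r}" "\<bar>lam k\<bar>"] that by (simp add: m1_def)
  have m1_nonneg: "0 \<le> m1" using m1[of "r+1"] assms(5) by simp
  have m2_nonneg: "0 \<le> m2" using m2[of "r+2"] assms(5) by simp
  \<comment> \<open>Were \<open>lam r\<close> not positive, the gap in modulus would put it below
    \<open>- m1\<close>, hence below \<open>lam (r + 1)\<close>.\<close>
  have "L > 0"
    using m1[of "r+1"] m1_less[of r] assms(4,5,8) by (auto simp: L_def)
  have L_le: "L \<le> lam k" if "k \<in> {1..r}" for k
  proof -
    from that have "k \<le> r" "1 \<le> k" by auto
    then show ?thesis unfolding L_def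
    proof (induction k rule: inc_induct)
      case (step m)
      then show ?case using assms(7)[rule_format, of m] by simp
    qed simp
  qed
  have d0: "0 \<le> d0" "d0 < 1"
    using assms(17,18) by (simp_all add: spectral_norm_nonneg)
  then have "d0\<^sup>2 < 1" by (simp add: abs_square_less_1)
  then have c: "0 < c" "c\<^sup>2 = 1 - d0\<^sup>2" by (auto simp: c_def)

  \<comment> \<open>Splitting of the identity along the eigenbasis\<close>
  have VV: "V ** transpose V = proj v {1..r}"
    and WW: "Vperp ** transpose Vperp = proj v {r+1..n}"
    using assms(5) by (simp_all add: assms(13,14) cols_from_mult_transpose r s)
  have split_all: "{1..n} = {1..r} \<union> {r+1..n}" "{r+1..n} = {r+1} \<union> {r+2..n}"
    using assms(5) by auto
  have VW: "V ** transpose V + Vperp ** transpose Vperp = mat 1"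
    using proj_all unfolding VV WW n by (subst (asm) split_all, subst (asm) proj_Un_disjoint) auto
  have V: "V \<in> orthonormal_mats" and W: "Vperp \<in> orthonormal_mats"
    using assms(5) by (auto simp: assms(13,14) n r s intro!: cols_from_orthonormal)
  have Q0: "Q0 \<in> orthonormal_mats" by (rule assms(16))
  have Qt: "Q t \<in> orthonormal_mats"
    using assms(19) Q0 by (cases t) (auto simp: subspace_iteration_def)
  have first: "d0 = dist_2 Q0 V"
    using dist_2_eq_spectral_norm[OF Q0 V W VW] d0(2) by (simp add: assms(17))

  \<comment> \<open>Inverse of the accumulated triangular factor\<close>
  obtain R where coords:
    "\<And>v l z. A *v v = l *\<^sub>R v \<Longrightarrow> v \<bullet> (Q t *v (R *v z)) = l ^ t * (v \<bullet> (Q0 *v z))"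
    using subspace_iteration_coords[OF assms(19,6)] by blast
  have coord: "v k \<bullet> (Q t *v (R *v z)) = lam k ^ t * (v k \<bullet> (Q0 *v z))" if "k \<in> {1..n}" for k z
    using coords assms(11) that by blast
  have "L ^ t * c * norm z \<le> norm (R *v z)" for z
  proof (rule power2_le_imp_le)
    have "(L ^ t * c * norm z)\<^sup>2 = (L ^ t)\<^sup>2 * (c\<^sup>2 * (norm z)\<^sup>2)"
      by (simp add: power_mult_distrib mult.assoc)
    also have "\<dots> \<le> (L ^ t)\<^sup>2 * (norm (transpose V *v (Q0 *v z)))\<^sup>2"
      using inner_subspace_below[OF Q0 VW, of z]
      by (intro mult_left_mono) (simp_all add: c(2) assms(17))
    also have "\<dots> = (\<Sum>k\<in>{1..r}. (L ^ t * (v k \<bullet> (Q0 *v z)))\<^sup>2)"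
      unfolding assms(13) norm_transpose_cols_from by (simp add: r sum_distrib_left power_mult_distrib)
    also have "\<dots> \<le> (\<Sum>k\<in>{1..r}. (lam k ^ t * (v k \<bullet> (Q0 *v z)))\<^sup>2)"
      unfolding power_mult_distrib using L_le \<open>L > 0\<close>
      by (intro sum_mono mult_right_mono power_mono) (auto simp: less_imp_le)
    also have "\<dots> = (norm (transpose V *v (Q t *v (R *v z))))\<^sup>2"
      unfolding assms(13) norm_transpose_cols_from using coord assms(5) by (simp add: r)
    also have "\<dots> \<le> (norm (R *v z))\<^sup>2"
      using norm_sq_complement[OF VW, of "Q t *v (R *v z)"]
        zero_le_power2[of "norm (transpose Vperp *v (Q t *v (R *v z)))"]
      unfolding norm_orthonormal_mult[OF Qt] by linarith
    finally show "(L ^ t * c * norm z)\<^sup>2 \<le> (norm (R *v z))\<^sup>2" .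
  qed simp
  then obtain H where RH: "R ** H = mat 1" and H: "spectral_norm H \<le> 1 / (L ^ t * c)"
    using bounded_below_inverse[of "L ^ t * c" R] \<open>L > 0\<close> c(1) by auto
  have H_norm: "norm (H *v y) \<le> norm y / (L ^ t * c)" for y
    using norm_le_spectral_norm[of H y] mult_right_mono[OF H norm_ge_zero[of y]] by simp
  \<comment> \<open>Taking \<open>H *v y\<close> for \<open>z\<close> expresses the coordinates of
    the current iterate through those of \<open>Q0\<close>.\<close>
  have coord_H: "v k \<bullet> (Q t *v y) = lam k ^ t * (v k \<bullet> (Q0 *v (H *v y)))" if "k \<in> {1..n}" for k y
    using coord[OF that, of "H *v y"] by (simp add: matrix_vector_mul_assoc RH flip: matrix_mul_assoc)

  \<comment> \<open>Decay of the trailing components\<close>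
  have tail: "norm (proj v K *v (Q t *v y)) \<le> (m / L) ^ t * (d0 / c) * norm y"
    if K: "K \<subseteq> {r+1..n}" and m: "\<And>k. k \<in> K \<Longrightarrow> \<bar>lam k\<bar> \<le> m" "0 \<le> m" for K m y
  proof -
    have Kn: "K \<subseteq> {1..CARD('n)}" using K n by auto
    have "(norm (proj v K *v (Q t *v y)))\<^sup>2 = (\<Sum>k\<in>K. (lam k ^ t * (v k \<bullet> (Q0 *v (H *v y))))\<^sup>2)"
      unfolding norm_proj_mult_vector[OF Kn]
      using Kn n by (intro sum.cong refl) (metis coord_H subsetD)
    also have "\<dots> \<le> (\<Sum>k\<in>K. (m ^ t)\<^sup>2 * (v k \<bullet> (Q0 *v (H *v y)))\<^sup>2)"
    proof (rule sum_mono)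
      fix k assume "k \<in> K"
      then have "\<bar>lam k ^ t\<bar> \<le> \<bar>m ^ t\<bar>"
        using m by (simp add: power_abs power_mono)
      then show "(lam k ^ t * (v k \<bullet> (Q0 *v (H *v y))))\<^sup>2 \<le> (m ^ t)\<^sup>2 * (v k \<bullet> (Q0 *v (H *v y)))\<^sup>2"
        unfolding power_mult_distrib abs_le_square_iff by (intro mult_right_mono) auto
    qed
    \<comment> \<open>The sum is enlarged to the whole tail because \<open>d0\<close> measures all
      of \<open>Vperp\<close> at once; only the rate \<open>m\<close> depends on
      \<open>K\<close>.\<close>
    also have "\<dots> \<le> (\<Sum>k\<in>{r+1..n}. (m ^ t)\<^sup>2 * (v k \<bullet> (Q0 *v (H *v y)))\<^sup>2)"
      using K by (intro sum_mono2) auto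
    also have "\<dots> = (m ^ t)\<^sup>2 * (norm (transpose Vperp *v (Q0 *v (H *v y))))\<^sup>2"
      unfolding assms(14) norm_transpose_cols_from using assms(5) by (simp add: s sum_distrib_left)
    also have "\<dots> = (m ^ t * norm (transpose (transpose Q0 ** Vperp) *v (H *v y)))\<^sup>2"
      by (simp add: power_mult_distrib matrix_transpose_mul matrix_vector_mul_assoc matrix_mul_assoc)
    finally have "norm (proj v K *v (Q t *v y))
        \<le> m ^ t * norm (transpose (transpose Q0 ** Vperp) *v (H *v y))"
      by (rule power2_le_imp_le) (simp add: m)
    also have "\<dots> \<le> m ^ t * (d0 * (norm y / (L ^ t * c)))"
      using norm_le_spectral_norm[of "transpose (transpose Q0 ** Vperp)" "H *v y"]
        mult_left_mono[OF H_norm[of y] d0(1)] m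
      by (intro mult_left_mono) (auto simp: spectral_norm_transpose assms(17))
    finally show ?thesis by (simp add: power_divide field_simps)
  qed

  \<comment> \<open>Choice of the orthogonal matrix \<open>X\<close>\<close>
  define N where "N = transpose Vperp ** Q t"
  have N_norm: "(norm (N *v y))\<^sup>2 = (norm (proj v {r+1..n} *v (Q t *v y)))\<^sup>2" for y
    using n assms(5) unfolding N_def assms(14)
    by (subst norm_proj_mult_vector) (auto simp: norm_transpose_cols_from s simp flip: matrix_vector_mul_assoc)
  have N: "spectral_norm N \<le> (m1 / L) ^ t * (d0 / c)"
  proof (rule spectral_norm_le)
    fix y
    have "norm (N *v y) = norm (proj v {r+1..n} *v (Q t *v y))"
      using N_norm[of y] by simp
    then show "norm (N *v y) \<le> (m1 / L) ^ t * (d0 / c) * norm y"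
      using tail[of "{r+1..n}" m1 y] m1 m1_nonneg by simp
  qed
  \<comment> \<open>The bound \<open>N\<close> may exceed 1. This second bound is what reduces
    \<open>(spectral_norm N)\<^sup>2\<close> to \<open>spectral_norm N\<close> in
    \<open>part1\<close>.\<close>
  have N1: "spectral_norm N \<le> 1"
  proof (rule spectral_norm_le)
    fix y
    have "(norm (N *v y))\<^sup>2 \<le> (norm y)\<^sup>2"
      using norm_sq_complement[OF VW, of "Q t *v y"] zero_le_power2[of "norm (transpose V *v (Q t *v y))"]
      unfolding norm_orthonormal_mult[OF Qt] N_def matrix_vector_mul_assoc by linarith
    then show "norm (N *v y) \<le> 1 * norm y" unfolding mult_1 by (rule power2_le_imp_le) simp
  qed
  have "transpose (transpose V ** Q t) ** (transpose V ** Q t) + transpose N ** N = mat 1"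
  proof -
    have "transpose (transpose V ** Q t) ** (transpose V ** Q t) + transpose N ** N
        = transpose (Q t) ** ((V ** transpose V + Vperp ** transpose Vperp) ** Q t)"
      by (simp add: N_def matrix_transpose_mul matrix_mult_add_rdistrib matrix_add_ldistrib
          flip: matrix_mul_assoc)
    then show ?thesis using Qt by (simp add: VW orthonormal_mats_def)
  qed
  then obtain X where X: "X \<in> orthonormal_mats"
    and MX: "spectral_norm (transpose V ** Q t - X) \<le> (spectral_norm N)\<^sup>2"
    by (rule near_orthogonal_matrix)

  \<comment> \<open>Bounds for the three parts of the error\<close>
  have decomp: "Q t - V ** X
      = V ** (transpose V ** Q t - X) + (proj v {r+1} ** Q t + proj v {r+2..n} ** Q t)"
  proof -
    have "Q t = (V ** transpose V + Vperp ** transpose Vperp) ** Q t" by (simp add: VW)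
    also have "Vperp ** transpose Vperp = proj v {r+1} + proj v {r+2..n}"
      unfolding WW split_all(2) by (rule proj_Un_disjoint) auto
    finally show ?thesis
      by (simp add: matrix_mult_add_rdistrib matrix_mult_diff_ldistrib matrix_mul_assoc)
  qed

  have rows: "norm_2_inf V \<le> \<mu> * sqrt (2 * real r / real n)"
  proof -
    have "norm_2_inf V = \<mu> * sqrt (real r / real n)"
      using coherence_mult_sqrt[OF V] by (simp add: assms(15) n r)
    moreover have "0 < \<mu>"
      using calculation norm_2_inf_orthonormal_pos[OF V] by (auto simp: zero_less_mult_iff divide_less_0_iff)
    ultimately show ?thesis
      by (simp add: divide_right_mono)
  qed
  have part1: "norm_2_inf (V ** (transpose V ** Q t - X))
      \<le> (m1 / L) ^ t * (\<mu> * sqrt (2 * real r / real n) * (d0 / c))"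
  proof -
    have "(spectral_norm N)\<^sup>2 \<le> spectral_norm N"
      using N1 spectral_norm_nonneg[of N] by (simp add: power2_eq_square mult_left_le)
    then have "spectral_norm (transpose V ** Q t - X) \<le> (m1 / L) ^ t * (d0 / c)"
      using MX N by linarith
    then have "norm_2_inf V * spectral_norm (transpose V ** Q t - X)
        \<le> (\<mu> * sqrt (2 * real r / real n)) * ((m1 / L) ^ t * (d0 / c))"
      using rows by (intro mult_mono) (auto intro: order_trans[OF norm_2_inf_nonneg] spectral_norm_nonneg)
    then show ?thesis
      using norm_2_inf_mult_le[of V "transpose V ** Q t - X"] by (simp add: mult_ac)
  qed
  have part3: "norm_2_inf (proj v {r+2..n} ** Q t) \<le> (m2 / L) ^ t * (d0 / c)"
  proof -
    have "spectral_norm (proj v {r+2..n} ** Q t) \<le> (m2 / L) ^ t * (d0 / c)"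
      using tail[of "{r+2..n}" m2] m2 m2_nonneg
      by (intro spectral_norm_le) (auto simp flip: matrix_vector_mul_assoc)
    then show ?thesis using norm_2_inf_le_spectral_norm order_trans by blast
  qed
  \<comment> \<open>\<open>B\<close> stands for the norm of the outer product in the conclusion,
    whose inner dimension is arbitrary; it only has to dominate the norm of the projection.\<close>
  have bound: "dist_2_inf (Q t) V
      \<le> (m1 / L) ^ t * (\<mu> * sqrt (2 * real r / real n) * (d0 / c) + B / c * dist_2_inf Q0 V)
        + (m2 / L) ^ t * (d0 / c)"
    if B: "norm_inf (proj v {r+1}) \<le> B" for B
  proof -
    have "0 \<le> B" using B norm_inf_nonneg order_trans by blast
    have part2: "norm_2_inf (proj v {r+1} ** Q t) \<le> (m1 / L) ^ t * (B / c) * norm_2_inf (Q0 - V ** Y)"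
      for Y
    proof -
      define l where "l = lam (r+1) ^ t"
      have l: "\<bar>l\<bar> \<le> m1 ^ t"
        using m1[of "r+1"] assms(5) by (simp add: l_def power_abs power_mono)
      have orth: "proj v {r+1} ** V = 0"
      proof -
        have "v (r+1) \<bullet> (V *v y) = 0" for y
        proof -
          have "v (r+1) \<bullet> (V *v y) = (transpose V *v v (r+1)) \<bullet> y"
            by (simp add: inner_matrix_vector_transpose)
          also have "transpose V *v v (r+1) = 0"
          proof -
            have "(norm (transpose V *v v (r+1)))\<^sup>2 = 0"
              unfolding assms(13) norm_transpose_cols_from
              using assms(5) n by (auto simp: r orthonormal intro!: sum.neutral)
            then show ?thesis by simp
          qed
          finally show ?thesis by simp
        qed
        then show ?thesis
          by (simp add: matrix_eq proj_mult_vector flip: matrix_vector_mul_assoc)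
      qed
      have "proj v {r+1} ** Q t = proj v {r+1} ** Q0 ** (l *\<^sub>R H)"
        using assms(5) coord_H[of "r+1"]
        by (simp add: matrix_eq proj_mult_vector l_def scaleR_matrix_vector_assoc[symmetric]
            matrix_vector_mult_scaleR flip: matrix_vector_mul_assoc)
      also have "proj v {r+1} ** Q0 = proj v {r+1} ** (Q0 - V ** Y)"
        unfolding matrix_mult_diff_ldistrib matrix_mul_assoc orth by simp
      finally have "norm_2_inf (proj v {r+1} ** Q t)
          \<le> norm_2_inf (proj v {r+1} ** (Q0 - V ** Y)) * spectral_norm (l *\<^sub>R H)"
        by (simp add: norm_2_inf_mult_le)
      also have "\<dots> \<le> (B * norm_2_inf (Q0 - V ** Y)) * (m1 ^ t * (1 / (L ^ t * c)))"
      proof (rule mult_mono)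
        show "norm_2_inf (proj v {r+1} ** (Q0 - V ** Y)) \<le> B * norm_2_inf (Q0 - V ** Y)"
          using norm_2_inf_mult_le_norm_inf mult_right_mono[OF B norm_2_inf_nonneg] order_trans by blast
        show "spectral_norm (l *\<^sub>R H) \<le> m1 ^ t * (1 / (L ^ t * c))"
        proof (rule spectral_norm_le)
          fix y
          have "norm ((l *\<^sub>R H) *v y) = \<bar>l\<bar> * norm (H *v y)"
            by (simp flip: scaleR_matrix_vector_assoc)
          also have "\<dots> \<le> m1 ^ t * (norm y / (L ^ t * c))"
            using l H_norm[of y] m1_nonneg by (intro mult_mono) auto
          finally show "norm ((l *\<^sub>R H) *v y) \<le> m1 ^ t * (1 / (L ^ t * c)) * norm y" by simp
        qed
      qed (auto simp: \<open>0 \<le> B\<close> norm_2_inf_nonneg spectral_norm_nonneg)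
      finally show ?thesis by (simp add: power_divide field_simps)
    qed
    have part2': "norm_2_inf (proj v {r+1} ** Q t) \<le> (m1 / L) ^ t * (B / c) * dist_2_inf Q0 V"
    \<comment> \<open>The infimum over \<open>Y\<close> is reached by dividing \<open>part2\<close>
      by its factor. The factor can vanish, for instance if \<open>m1 = 0\<close> and
      \<open>t > 0\<close>; then \<open>part2\<close> for any single \<open>Y\<close> already
      suffices.\<close>
    proof (cases "(m1 / L) ^ t * (B / c) = 0")
      case True
      then show ?thesis using part2[of "mat 1"] unfolding True by simp
    next
      case False
      moreover have "0 \<le> (m1 / L) ^ t * (B / c)"
        using m1_nonneg \<open>L > 0\<close> \<open>0 \<le> B\<close> c(1) by simp
      ultimately have b: "0 < (m1 / L) ^ t * (B / c)"
        by (rule order_neq_le_trans[OF not_sym])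
      have "norm_2_inf (proj v {r+1} ** Q t) / ((m1 / L) ^ t * (B / c)) \<le> dist_2_inf Q0 V"
        unfolding dist_2_inf_def
      proof (rule cINF_greatest)
        show "(orthonormal_mats :: (real^'r::{finite,linorder}^'r::{finite,linorder}) set) \<noteq> {}" using X by blast
      next
        fix Y :: "real^'r::{finite,linorder}^'r::{finite,linorder}"
        show "norm_2_inf (proj v {r+1} ** Q t) / ((m1 / L) ^ t * (B / c)) \<le> norm_2_inf (Q0 - V ** Y)"
          unfolding pos_divide_le_eq[OF b] using part2[of Y] by (subst mult.commute)
      qed
      then show ?thesis unfolding pos_divide_le_eq[OF b] by (subst mult.commute)
    qed
    have "dist_2_inf (Q t) V \<le> norm_2_inf (Q t - V ** X)"
      by (rule dist_2_inf_le[OF X])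
    also have "\<dots> \<le> norm_2_inf (V ** (transpose V ** Q t - X))
        + (norm_2_inf (proj v {r+1} ** Q t) + norm_2_inf (proj v {r+2..n} ** Q t))"
      unfolding decomp by (rule order_trans[OF norm_2_inf_add_le add_left_mono[OF norm_2_inf_add_le]])
    also have "\<dots> \<le> (m1 / L) ^ t * (\<mu> * sqrt (2 * real r / real n) * (d0 / c))
        + ((m1 / L) ^ t * (B / c) * dist_2_inf Q0 V + (m2 / L) ^ t * (d0 / c))"
      by (intro add_mono part1 part2' part3)
    also have "\<dots> = (m1 / L) ^ t * (\<mu> * sqrt (2 * real r / real n) * (d0 / c) + B / c * dist_2_inf Q0 V)
        + (m2 / L) ^ t * (d0 / c)"
      by (simp only: distrib_left add.assoc mult.assoc)
    finally show ?thesis .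
  qed
  show ?thesis
    using first bound[OF norm_inf_proj_le] unfolding m1_def m2_def L_def c_def by (rule conjI)
qed

end
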